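(* Let $D$ be an integral domain with quotient field $K$, and let $\mathcal{S}$ be a multiplicative set of finitely generated nonzero ideals of $D$. Then the map $A \mapsto A_{\mathcal{S}}$ ($A \in F(D)$) is a star-operation if and only if $\mathcal{S} \subseteq \mathcal{S}_v$. In this case the star-operation $A \mapsto A_{\mathcal{S}}$ has finite character.
   Context: $K^\ast = K\setminus\{0\}$. A fractional ideal of $D$ is a $D$-submodule $A$ of $K$ with $xA \subseteq D$ for some nonzero $x \in D$. $F(D)$ is the set of nonzero fractional ideals of $D$, $f(D)$ the set of nonzero finitely generated fractional ideals, and $I(D)$ the set of nonzero (integral) ideals of $D$. A star-operation on $F(D)$ is a map $\star: F(D) \to F(D)$, $A \mapsto A^\star$, such that for all $A,B \in F(D)$ and $a \in K^\ast$: (1) $(a)^\star = (a)$ and $(aA)^\star = aA^\star$; (2) $A \subseteq A^\star$, and $A \subseteq B$ implies $A^\star \subseteq B^\star$; (3) $(A^\star)^\star = A^\star$. A star-operation $\star$ has finite character if $A^\star = \bigcup\{B^\star \mid B \in f(D),\ B \subseteq A\}$ for every $A \in F(D)$. A multiplicative (multiplicatively closed) set of ideals of $D$ is a nonempty set $\mathcal{S}$ of ideals of $D$ such that $I,J\in\mathcal{S}$ implies $IJ \in \mathcal{S}$. For a $D$-submodule $A$ of $K$, $A_{\mathcal{S}} = \{x \in K \mid xI \subseteq A \text{ for some } I \in \mathcal{S}\}$. For $A\in F(D)$, $A^{-1} = \{x \in K \mid xA \subseteq D\}$ and $A_v = (A^{-1})^{-1}$. $\mathcal{S}_v = \{I \in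 I(D) \mid I_v = D\}$ (equivalently, $I^{-1}=D$). *)

theory Defs
  imports
    "HOL-Computational_Algebra.Polynomial_Factorial"
    "HOL-Library.Set_Algebras"
begin

text \<open>
  The domain \<open>D\<close> is a type \<open>'a::idom\<close> and \<open>K\<close> is its fraction field \<open>'a fract\<close>. As usual, \<open>D\<close> is
  identified with its image in \<open>K\<close>, so that ideals and fractional ideals alike are
  subsets of \<open>K\<close>; see \<open>ideal_iff_image\<close> below.
\<close>

abbreviation dom_in_fract :: "'a::idom fract set" where
  "dom_in_fract \<equiv> range to_fract"

definition fract_scale :: "'a::idom \<Rightarrow> 'a fract \<Rightarrow> 'a fract" where
  "fract_scale a x = to_fract a * x"

text \<open>\<open>K\<close> as a \<open>D\<close>-module: \<open>fract.subspace\<close> means \<open>D\<close>-submodule, \<open>fract.span\<close> is the \<open>D\<close>-span.\<close>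

interpretation fract: module fract_scale
  by standard (simp_all add: fract_scale_def algebra_simps)

definition fin_gen :: "'a::idom fract set \<Rightarrow> bool" where
  "fin_gen A \<longleftrightarrow> (\<exists>B. finite B \<and> A = fract.span B)"

text \<open>The set \<open>F(D)\<close>; the zero module is excluded.\<close>

definition frac_ideals :: "'a::idom fract set set" where
  "frac_ideals = {A. fract.subspace A \<and> A \<noteq> {0} \<and>
     (\<exists>x::'a. x \<noteq> 0 \<and> to_fract x *o A \<subseteq> dom_in_fract)}"

text \<open>The set \<open>f(D)\<close>.\<close>

definition fg_frac_ideals :: "'a::idom fract set set" where
  "fg_frac_ideals = {A \<in> frac_ideals. fin_gen A}"

definition ideal :: "'a::idom fract set \<Rightarrow> bool" where
  "ideal I \<longleftrightarrow> fract.subspace I \<and> I \<subseteq> dom_in_fract"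

lemma ideal_iff_image:
  fixes I :: "'a::idom fract set"
  shows "ideal I \<longleftrightarrow> (\<exists>J. module.subspace ((*) :: 'a \<Rightarrow> 'a \<Rightarrow> 'a) J \<and> I = to_fract ` J)"
proof -
  interpret D: module "(*) :: 'a \<Rightarrow> 'a \<Rightarrow> 'a"
    by standard (simp_all add: algebra_simps)
  show ?thesis
  proof
    assume I: "ideal I"
    have "D.subspace (to_fract -` I)"
      using I unfolding ideal_def D.subspace_def fract.subspace_def fract_scale_def by simp
    moreover have "I = to_fract ` (to_fract -` I)"
      using I unfolding ideal_def by blast
    ultimately show "\<exists>J. D.subspace J \<and> I = to_fract ` J" by blast
  next
    assume "\<exists>J. D.subspace J \<and> I = to_fract ` J"
    then obtain J where J: "D.subspace J" and I: "I = to_fract ` J" by blast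
    have "fract.subspace I"
      unfolding fract.subspace_def fract_scale_def I
    proof (intro conjI ballI allI)
      show "0 \<in> to_fract ` J"
        using D.subspace_0[OF J] by (metis imageI to_fract_0)
    next
      fix x y :: "'a fract" assume "x \<in> to_fract ` J" "y \<in> to_fract ` J"
      then show "x + y \<in> to_fract ` J"
        using D.subspace_add[OF J] by (auto simp flip: to_fract_add)
    next
      fix c :: 'a and x assume "x \<in> to_fract ` J"
      then show "to_fract c * x \<in> to_fract ` J"
        using D.subspace_scale[OF J] by (auto simp flip: to_fract_mult)
    qed
    then show "ideal I" unfolding ideal_def I by blast
  qed
qed

text \<open>The set \<open>I(D)\<close>.\<close>

definition integral_ideals :: "'a::idom fract set set" where
  "integral_ideals = {I. ideal I \<and> I \<noteq> {0}}"

text \<open>\<open>I * J\<close> is only the set of all products \<open>x * y\<close>; the product ideal is its \<open>D\<close>-span.\<close>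

definition ideal_prod :: "'a::idom fract set \<Rightarrow> 'a fract set \<Rightarrow> 'a fract set" where
  "ideal_prod I J = fract.span (I * J)"

definition multiplicative_set :: "'a::idom fract set set \<Rightarrow> bool" where
  "multiplicative_set S \<longleftrightarrow>
     S \<noteq> {} \<and> (\<forall>I\<in>S. ideal I) \<and> (\<forall>I\<in>S. \<forall>J\<in>S. ideal_prod I J \<in> S)"

text \<open>The module \<open>A\<^sub>S\<close>.\<close>

definition gen_transform :: "'a::idom fract set set \<Rightarrow> 'a fract set \<Rightarrow> 'a fract set" where
  "gen_transform S A = {x. \<exists>I\<in>S. x *o I \<subseteq> A}"

definition frac_inverse :: "'a::idom fract set \<Rightarrow> 'a fract set" where
  "frac_inverse A = {x. x *o A \<subseteq> dom_in_fract}"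

definition v_closure :: "'a::idom fract set \<Rightarrow> 'a fract set" where
  "v_closure A = frac_inverse (frac_inverse A)"

definition v_dense_ideals :: "'a::idom fract set set" where
  "v_dense_ideals = {I \<in> integral_ideals. v_closure I = dom_in_fract}"

text \<open>Only the values of \<open>star\<close> on \<open>F(D)\<close> matter; \<open>fract.span {a}\<close> is the principal ideal \<open>(a)\<close>.\<close>

definition star_operation :: "('a::idom fract set \<Rightarrow> 'a fract set) \<Rightarrow> bool" where
  "star_operation star \<longleftrightarrow>
     (\<forall>A\<in>frac_ideals. star A \<in> frac_ideals) \<and>
     (\<forall>a. a \<noteq> 0 \<longrightarrow> star (fract.span {a}) = fract.span {a}) \<and>
     (\<forall>a. \<forall>A\<in>frac_ideals. a \<noteq> 0 \<longrightarrow> star (a *o A) = a *o star A) \<and>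
     (\<forall>A\<in>frac_ideals. A \<subseteq> star A) \<and>
     (\<forall>A\<in>frac_ideals. \<forall>B\<in>frac_ideals. A \<subseteq> B \<longrightarrow> star A \<subseteq> star B) \<and>
     (\<forall>A\<in>frac_ideals. star (star A) = star A)"

definition finite_character :: "('a::idom fract set \<Rightarrow> 'a fract set) \<Rightarrow> bool" where
  "finite_character star \<longleftrightarrow>
     (\<forall>A\<in>frac_ideals. star A = \<Union> {star B | B. B \<in> fg_frac_ideals \<and> B \<subseteq> A})"

end

theory Submission
  imports Defs
begin

text \<open>
  An ideal \<open>I\<close> satisfies \<open>I\<^sub>v = D\<close> iff \<open>I\<^sup>-\<^sup>1 = D\<close>. As \<open>D\<^sub>S\<close> is the union of the \<open>I\<^sup>-\<^sup>1\<close> with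
  \<open>I \<in> S\<close>, this holds for all \<open>I \<in> S\<close> iff \<open>D\<^sub>S = D\<close>, which is an instance of the first
  axiom of a star-operation. Conversely, \<open>D\<^sub>S = D\<close> gives the first axiom for all principal
  ideals by scaling, and a denominator of \<open>A\<close> is then also one of \<open>A\<^sub>S\<close>. Idempotence rests on finite
  generation: finitely many elements of \<open>A\<^sub>S\<close> are multiplied into \<open>A\<close> by one common
  \<open>J \<in> S\<close>. So does finite character: if \<open>x I \<subseteq> A\<close>, then \<open>x \<in> (x I)\<^sub>S\<close>.
\<close>

section \<open>Scaled sets, submodules and spans in the fraction field\<close>

lemma elt_times_subset_iff: "x *o A \<subseteq> B \<longleftrightarrow> (\<forall>a\<in>A. x * a \<in> B)"
  by (auto simp: elt_set_times_def)

lemma mem_elt_times_iff: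
  fixes a :: "'a::field"
  assumes "a \<noteq> 0"
  shows "x \<in> a *o A \<longleftrightarrow> inverse a * x \<in> A"
proof
  assume "x \<in> a *o A"
  then show "inverse a * x \<in> A"
    using assms by (auto simp: elt_set_times_def simp flip: mult.assoc)
next
  assume "inverse a * x \<in> A"
  moreover have "x = a * (inverse a * x)"
    using assms by (simp flip: mult.assoc)
  ultimately show "x \<in> a *o A"
    unfolding elt_set_times_def by blast
qed

lemma subspace_mult: "fract.subspace A \<Longrightarrow> x \<in> A \<Longrightarrow> to_fract c * x \<in> A"
  using fract.subspace_scale by (auto simp: fract_scale_def)

lemma span_singleton_fract: "fract.span {a} = a *o dom_in_fract"
  unfolding fract.span_singleton by (auto simp: elt_set_times_def fract_scale_def mult.commute)

lemma span_one_fract: "fract.span {1} = dom_in_fract"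
  by (simp add: span_singleton_fract elt_set_times_def)

lemma subspace_dom: "fract.subspace dom_in_fract"
  by (metis span_one_fract fract.subspace_span)

lemma subspace_elt_times:
  assumes "fract.subspace A"
  shows "fract.subspace (x *o A)"
  unfolding fract.subspace_def
proof (intro conjI ballI allI)
  show "0 \<in> x *o A"
    using fract.subspace_0[OF assms] by (force simp: elt_set_times_def)
next
  fix y z assume "y \<in> x *o A" "z \<in> x *o A"
  then obtain a b where "a \<in> A" "b \<in> A" "y + z = x * (a + b)"
    by (auto simp: elt_set_times_def distrib_left)
  then show "y + z \<in> x *o A"
    using fract.subspace_add[OF assms] by (auto simp: elt_set_times_def)
next
  fix c y assume "y \<in> x *o A"
  then obtain a where "a \<in> A" "fract_scale c y = x * fract_scale c a"
    by (auto simp: elt_set_times_def fract_scale_def mult.left_commute)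
  then show "fract_scale c y \<in> x *o A"
    using fract.subspace_scale[OF assms] by (auto simp: elt_set_times_def)
qed

lemma subspace_mult_preimage:
  assumes "fract.subspace A"
  shows "fract.subspace {y. x * y \<in> A}"
  using assms unfolding fract.subspace_def
  by (auto simp: distrib_left fract_scale_def mult.left_commute[of x])

text \<open>The elements that \<open>x\<close> multiplies into \<open>A\<close> form a submodule, so
  it is enough to test the generators.\<close>

lemma mult_span_mem:
  assumes "fract.subspace A" "\<And>b. b \<in> B \<Longrightarrow> x * b \<in> A" "i \<in> fract.span B"
  shows "x * i \<in> A"
proof -
  have "fract.span B \<subseteq> {y. x * y \<in> A}"
    using assms by (intro fract.span_minimal subspace_mult_preimage) auto
  with assms(3) show ?thesis by blast
qed

lemma fin_gen_elt_times:
  assumes "fin_gen I"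
  shows "fin_gen (x *o I)"
proof -
  obtain B where B: "finite B" "I = fract.span B"
    using assms by (auto simp: fin_gen_def)
  have "x *o fract.span B = fract.span ((*) x ` B)"
  proof
    show "x *o fract.span B \<subseteq> fract.span ((*) x ` B)"
      unfolding elt_times_subset_iff
      by (blast intro: mult_span_mem[OF fract.subspace_span] fract.span_base)
    show "fract.span ((*) x ` B) \<subseteq> x *o fract.span B"
      by (intro fract.span_minimal subspace_elt_times fract.subspace_span)
        (auto simp: elt_set_times_def intro: fract.span_base)
  qed
  with B show ?thesis
    unfolding fin_gen_def by blast
qed

text \<open>A common denominator of \<open>A\<close> also serves every subset of
  \<open>A\<close>.\<close>

lemma frac_ideals_subset:
  assumes "A \<in> frac_ideals" "fract.subspace B" "B \<subseteq> A" "B \<noteq> {0}"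
  shows "B \<in> frac_ideals"
  using assms unfolding frac_ideals_def elt_times_subset_iff by blast

lemma subspace_nonzero_element:
  assumes "fract.subspace A" "A \<noteq> {0}"
  obtains a where "a \<in> A" "a \<noteq> 0"
  using assms fract.subspace_0 by blast

section \<open>Inverses and the v-closure of integral ideals\<close>

lemma frac_inverse_dom: "frac_inverse dom_in_fract = dom_in_fract"
proof
  show "frac_inverse dom_in_fract \<subseteq> (dom_in_fract :: 'a fract set)"
  proof
    fix x :: "'a fract" assume "x \<in> frac_inverse dom_in_fract"
    then have "x * to_fract 1 \<in> dom_in_fract"
      unfolding frac_inverse_def elt_times_subset_iff by blast
    then show "x \<in> dom_in_fract" by simp
  qed
  show "dom_in_fract \<subseteq> (frac_inverse dom_in_fract :: 'a fract set)"
    unfolding frac_inverse_def elt_times_subset_iff by (auto simp flip: to_fract_mult)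
qed

lemma dom_subset_frac_inverse: "ideal I \<Longrightarrow> dom_in_fract \<subseteq> frac_inverse I"
  unfolding ideal_def frac_inverse_def elt_times_subset_iff using subspace_mult by blast

lemma v_closure_eq_dom_iff:
  assumes "ideal I"
  shows "v_closure I = dom_in_fract \<longleftrightarrow> frac_inverse I \<subseteq> dom_in_fract"
proof
  assume "v_closure I = dom_in_fract"
  \<comment> \<open>That 1 lies in the inverse of \<open>frac_inverse I\<close> says exactly that
    \<open>frac_inverse I\<close> lies in \<open>D\<close>.\<close>
  then have "1 \<in> v_closure I"
    by (metis rangeI to_fract_1)
  then show "frac_inverse I \<subseteq> dom_in_fract"
    by (auto simp: v_closure_def frac_inverse_def[of "frac_inverse I"] elt_times_subset_iff)
next
  assume "frac_inverse I \<subseteq> dom_in_fract"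
  then have "frac_inverse I = dom_in_fract"
    using dom_subset_frac_inverse[OF assms] by blast
  then show "v_closure I = dom_in_fract"
    by (simp add: v_closure_def frac_inverse_dom)
qed

section \<open>Closure properties of the transform\<close>

lemma gen_transform_dom: "gen_transform S dom_in_fract = (\<Union>I\<in>S. frac_inverse I)"
  by (auto simp: gen_transform_def frac_inverse_def)

lemma mem_gen_transform: "x \<in> gen_transform S A \<longleftrightarrow> (\<exists>I\<in>S. \<forall>i\<in>I. x * i \<in> A)"
  by (simp add: gen_transform_def elt_times_subset_iff)

lemma gen_transform_mono: "A \<subseteq> B \<Longrightarrow> gen_transform S A \<subseteq> gen_transform S B"
  unfolding gen_transform_def by blast

text \<open>Since \<open>x * i\<close> lies in \<open>a *o A\<close> iff
  \<open>inverse a * x * i\<close> lies in \<open>A\<close>, the same ideal of \<open>S\<close>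
  witnesses both memberships.\<close>

lemma gen_transform_elt_times:
  assumes "a \<noteq> 0"
  shows "gen_transform S (a *o A) = a *o gen_transform S A"
  by (rule set_eqI) (simp add: mem_elt_times_iff[OF assms] mem_gen_transform mult.assoc)

lemma ideal_prod_subset:
  assumes "ideal I" "ideal J"
  shows "ideal_prod I J \<subseteq> I" "ideal_prod I J \<subseteq> J"
proof -
  have "x * y \<in> I \<and> x * y \<in> J" if x: "x \<in> I" and y: "y \<in> J" for x y
  proof -
    \<comment> \<open>Both factors lie in \<open>D\<close>, so each can act as a scalar on the ideal
      containing the other.\<close>
    obtain c d where "x = to_fract c" "y = to_fract d"
      using assms x y unfolding ideal_def by blast
    then show ?thesis
      using assms x y subspace_mult[of I x d] subspace_mult[of J y c]
      by (simp add: ideal_def mult.commute)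
  qed
  then have "I * J \<subseteq> I" "I * J \<subseteq> J"
    by (auto simp: set_times_def)
  then show "ideal_prod I J \<subseteq> I" "ideal_prod I J \<subseteq> J"
    using assms unfolding ideal_prod_def ideal_def by (simp_all add: fract.span_minimal)
qed

lemma multiplicative_setD:
  assumes "multiplicative_set S"
  shows "S \<noteq> {}" "I \<in> S \<Longrightarrow> ideal I" "I \<in> S \<Longrightarrow> J \<in> S \<Longrightarrow> ideal_prod I J \<in> S"
  using assms by (auto simp: multiplicative_set_def)

text \<open>A product of two ideals lies in both factors, so \<open>S\<close> is directed downwards;
  the empty family only needs \<open>S\<close> to be nonempty.\<close>

lemma multiplicative_set_lower_bound:
  assumes "multiplicative_set S" "finite \<J>" "\<J> \<subseteq> S"
  shows "\<exists>J\<in>S. \<forall>I\<in>\<J>. J \<subseteq> I"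
  using assms(2,3)
proof (induction \<J>)
  case empty
  then show ?case using multiplicative_setD(1)[OF assms(1)] by auto
next
  case (insert I \<J>)
  then obtain J where J: "J \<in> S" "\<forall>I'\<in>\<J>. J \<subseteq> I'" and I: "I \<in> S" by auto
  note ideals = multiplicative_setD(2)[OF assms(1) I] multiplicative_setD(2)[OF assms(1) J(1)]
  have "ideal_prod I J \<in> S"
    by (rule multiplicative_setD(3)[OF assms(1) I J(1)])
  moreover have "\<forall>I'\<in>insert I \<J>. ideal_prod I J \<subseteq> I'"
    using ideal_prod_subset[OF ideals] J(2) by blast
  ultimately show ?case by blast
qed

text \<open>Each \<open>b\<close> has its own ideal in \<open>S\<close>; a member of
  \<open>S\<close> below these finitely many ideals works for all \<open>b\<close> at once.\<close>

lemma gen_transform_common_multiplier: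
  assumes "multiplicative_set S" "finite B" "B \<subseteq> gen_transform S A"
  shows "\<exists>J\<in>S. \<forall>b\<in>B. \<forall>j\<in>J. b * j \<in> A"
proof -
  have "\<forall>b\<in>B. \<exists>I. I \<in> S \<and> (\<forall>i\<in>I. b * i \<in> A)"
    using assms(3) by (auto simp: mem_gen_transform subset_iff)
  then obtain f where f: "\<forall>b\<in>B. f b \<in> S \<and> (\<forall>i\<in>f b. b * i \<in> A)"
    by (auto simp: bchoice_iff)
  then obtain J where "J \<in> S" "\<forall>I\<in>f ` B. J \<subseteq> I"
    using multiplicative_set_lower_bound[OF assms(1), of "f ` B"] assms(2) by auto
  with f show ?thesis by blast
qed

lemma subspace_gen_transform:
  assumes S: "multiplicative_set S" and A: "fract.subspace A"
  shows "fract.subspace (gen_transform S A)"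
  unfolding fract.subspace_def
proof (intro conjI ballI allI)
  show "0 \<in> gen_transform S A"
    using multiplicative_setD(1)[OF S] fract.subspace_0[OF A] by (auto simp: mem_gen_transform)
next
  fix x y assume "x \<in> gen_transform S A" "y \<in> gen_transform S A"
  then obtain J where "J \<in> S" "\<forall>b\<in>{x, y}. \<forall>j\<in>J. b * j \<in> A"
    using gen_transform_common_multiplier[OF S, of "{x, y}"] by blast
  moreover from this have "\<forall>j\<in>J. (x + y) * j \<in> A"
    using fract.subspace_add[OF A] by (simp add: distrib_right)
  ultimately show "x + y \<in> gen_transform S A"
    unfolding mem_gen_transform by blast
next
  fix c x assume "x \<in> gen_transform S A"
  then show "fract_scale c x \<in> gen_transform S A"
    using subspace_mult[OF A] by (auto simp: mem_gen_transform fract_scale_def mult.assoc)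
qed

text \<open>Members of \<open>S\<close> consist of elements of \<open>D\<close>, so any one of them
  multiplies the submodule \<open>A\<close> into itself.\<close>

lemma gen_transform_extensive:
  assumes S: "multiplicative_set S" and A: "fract.subspace A"
  shows "A \<subseteq> gen_transform S A"
proof
  fix a assume a: "a \<in> A"
  obtain I where I: "I \<in> S" using multiplicative_setD(1)[OF S] by blast
  have "I \<subseteq> dom_in_fract"
    using multiplicative_setD(2)[OF S I] by (simp add: ideal_def)
  then have "\<forall>i\<in>I. a * i \<in> A"
    using subspace_mult[OF A a] by (auto simp: mult.commute[of a])
  with I show "a \<in> gen_transform S A" by (auto simp: mem_gen_transform)
qed

text \<open>Let \<open>I\<close> multiply \<open>x\<close> into the transform of \<open>A\<close>.
  Some \<open>J\<close> in \<open>S\<close> multiplies the finitely many products of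
  \<open>x\<close> with generators of \<open>I\<close> into \<open>A\<close>, and then the product
  of \<open>I\<close> and \<open>J\<close> multiplies \<open>x\<close> into
  \<open>A\<close>.\<close>

lemma gen_transform_idem:
  assumes S: "multiplicative_set S" and fg: "\<forall>I\<in>S. fin_gen I" and A: "fract.subspace A"
  shows "gen_transform S (gen_transform S A) = gen_transform S A"
proof
  show "gen_transform S A \<subseteq> gen_transform S (gen_transform S A)"
    by (rule gen_transform_extensive[OF S subspace_gen_transform[OF S A]])
  show "gen_transform S (gen_transform S A) \<subseteq> gen_transform S A"
  proof
    fix x assume "x \<in> gen_transform S (gen_transform S A)"
    then obtain I where I: "I \<in> S" "\<forall>i\<in>I. x * i \<in> gen_transform S A"
      by (auto simp: mem_gen_transform)
    obtain B where B: "finite B" "I = fract.span B"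
      using fg I(1) by (auto simp: fin_gen_def)
    have "(*) x ` B \<subseteq> gen_transform S A"
      using I(2) B(2) fract.span_base by auto
    then obtain J where J: "J \<in> S" "\<forall>b\<in>(*) x ` B. \<forall>j\<in>J. b * j \<in> A"
      using gen_transform_common_multiplier[OF S, of "(*) x ` B"] B(1) by blast
    have "x * (i * j) \<in> A" if "i \<in> I" "j \<in> J" for i j
    proof -
      \<comment> \<open>With \<open>j\<close> fixed, \<open>x * j\<close> is the multiplier, and
        only the generators \<open>b\<close> of \<open>I\<close> have to be tested.\<close>
      have "x * j * i \<in> A"
      proof (rule mult_span_mem[OF A])
        show "x * j * b \<in> A" if "b \<in> B" for b
          using J(2) that \<open>j \<in> J\<close> by (auto simp: ac_simps)
        show "i \<in> fract.span B" using that(1) B(2) by simp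
      qed
      then show ?thesis by (simp add: ac_simps)
    qed
    then have "x * k \<in> A" if "k \<in> I * J" for k
      using that by (auto simp: set_times_def)
    then have "\<forall>k\<in>ideal_prod I J. x * k \<in> A"
      unfolding ideal_prod_def using mult_span_mem[OF A] by blast
    with multiplicative_setD(3)[OF S I(1) J(1)] show "x \<in> gen_transform S A"
      by (auto simp: mem_gen_transform)
  qed
qed

section \<open>The star-operation criterion and finite character\<close>

lemma gen_transform_dom_eq_iff:
  assumes S: "multiplicative_set S" and nz: "\<forall>I\<in>S. I \<noteq> {0}"
  shows "gen_transform S dom_in_fract = dom_in_fract \<longleftrightarrow> S \<subseteq> v_dense_ideals"
proof -
  have "gen_transform S dom_in_fract = dom_in_fract \<longleftrightarrow> (\<forall>I\<in>S. frac_inverse I \<subseteq> dom_in_fract)"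
    using gen_transform_extensive[OF S subspace_dom] unfolding gen_transform_dom by blast
  also have "\<dots> \<longleftrightarrow> (\<forall>I\<in>S. I \<in> v_dense_ideals)"
  proof (intro ball_cong refl)
    fix I assume "I \<in> S"
    then show "frac_inverse I \<subseteq> dom_in_fract \<longleftrightarrow> I \<in> v_dense_ideals"
      using multiplicative_setD(2)[OF S] nz v_closure_eq_dom_iff[of I]
      by (simp add: v_dense_ideals_def integral_ideals_def)
  qed
  also have "\<dots> \<longleftrightarrow> S \<subseteq> v_dense_ideals" by blast
  finally show ?thesis .
qed

lemma gen_transform_frac_ideal:
  assumes S: "multiplicative_set S" and D: "gen_transform S dom_in_fract = dom_in_fract"
    and A: "A \<in> frac_ideals"
  shows "gen_transform S A \<in> frac_ideals"
proof -
  have sub: "fract.subspace A" "A \<noteq> {0}"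
    using A by (auto simp: frac_ideals_def)
  obtain d where d: "d \<noteq> 0" "to_fract d *o A \<subseteq> dom_in_fract"
    using A by (auto simp: frac_ideals_def)
  obtain a where "a \<in> A" "a \<noteq> 0"
    using sub by (rule subspace_nonzero_element)
  then have "gen_transform S A \<noteq> {0}"
    using gen_transform_extensive[OF S sub(1)] by blast
  \<comment> \<open>Transforming the inclusion of \<open>to_fract d *o A\<close> in \<open>D\<close>
    leaves its right side fixed, and the scalar moves out on the left.\<close>
  moreover have "to_fract d *o gen_transform S A \<subseteq> dom_in_fract"
    using gen_transform_mono[OF d(2), of S] d(1) by (simp add: gen_transform_elt_times D)
  ultimately show ?thesis
    using subspace_gen_transform[OF S sub(1)] d(1) by (auto simp: frac_ideals_def)
qed

lemma star_operation_gen_transform: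
  assumes S: "multiplicative_set S" and fg: "\<forall>I\<in>S. fin_gen I"
    and D: "gen_transform S dom_in_fract = dom_in_fract"
  shows "star_operation (gen_transform S)"
proof -
  have sub: "fract.subspace A" if "A \<in> frac_ideals" for A :: "'a fract set"
    using that by (simp add: frac_ideals_def)
  \<comment> \<open>The axiom on principal ideals reduces to \<open>D\<close> because
    \<open>(a)\<close> is \<open>a *o dom_in_fract\<close>.\<close>
  show ?thesis
    unfolding star_operation_def
    using gen_transform_frac_ideal[OF S D] gen_transform_extensive[OF S sub]
      gen_transform_idem[OF S fg sub] gen_transform_mono[of _ _ S]
    by (auto simp: span_singleton_fract gen_transform_elt_times D)
qed

text \<open>The axiom on principal ideals is used at \<open>a = 1\<close>, where \<open>(1)\<close>
  is \<open>D\<close>.\<close>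

lemma star_operation_dom:
  assumes "star_operation star"
  shows "star dom_in_fract = dom_in_fract"
  using assms unfolding star_operation_def by (metis span_one_fract zero_neq_one)

lemma finite_character_gen_transform:
  assumes S: "multiplicative_set S" and fg: "\<forall>I\<in>S. fin_gen I \<and> I \<noteq> {0}"
  shows "finite_character (gen_transform S)"
  unfolding finite_character_def
proof (intro ballI equalityI subsetI)
  fix A x assume A: "A \<in> frac_ideals" and x: "x \<in> gen_transform S A"
  have sub: "fract.subspace A" "A \<noteq> {0}"
    using A by (auto simp: frac_ideals_def)
  have "\<exists>B. B \<in> fg_frac_ideals \<and> B \<subseteq> A \<and> x \<in> gen_transform S B"
  \<comment> \<open>For \<open>x = 0\<close> the module \<open>x *o I\<close> is zero and hence not
    in \<open>F(D)\<close>; a nonzero principal submodule of \<open>A\<close> takes its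
    place.\<close>
  proof (cases "x = 0")
    case True
    obtain a where a: "a \<in> A" "a \<noteq> 0"
      using sub by (rule subspace_nonzero_element)
    have le: "fract.span {a} \<subseteq> A"
      using a(1) sub(1) by (simp add: fract.span_minimal)
    moreover have "fract.span {a} \<in> fg_frac_ideals"
      unfolding fg_frac_ideals_def fin_gen_def
      using frac_ideals_subset[OF A fract.subspace_span le] a(2) fract.span_base[of a "{a}"]
      by blast
    moreover have "x \<in> gen_transform S (fract.span {a})"
      using subspace_gen_transform[OF S fract.subspace_span] fract.subspace_0 True by blast
    ultimately show ?thesis by blast
  next
    case False
    obtain I where I: "I \<in> S" "x *o I \<subseteq> A"
      using x by (auto simp: gen_transform_def)
    have subI: "fract.subspace I"
      using multiplicative_setD(2)[OF S I(1)] by (simp add: ideal_def)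
    obtain i where i: "i \<in> I" "i \<noteq> 0"
      using subI fg I(1) subspace_nonzero_element by metis
    have "x * i \<in> x *o I" "x * i \<noteq> 0"
      using i False by auto
    then have "x *o I \<in> frac_ideals"
      using frac_ideals_subset[OF A subspace_elt_times[OF subI] I(2)] by blast
    then have "x *o I \<in> fg_frac_ideals"
      using fg I(1) fin_gen_elt_times by (auto simp: fg_frac_ideals_def)
    \<comment> \<open>The witness is \<open>x *o I\<close>, and \<open>I\<close> itself shows that
      \<open>x\<close> lies in its transform.\<close>
    then show ?thesis
      using I by (auto simp: gen_transform_def)
  qed
  then show "x \<in> \<Union> {gen_transform S B | B. B \<in> fg_frac_ideals \<and> B \<subseteq> A}"
    by blast
next
  fix A x assume "x \<in> \<Union> {gen_transform S B | B. B \<in> fg_frac_ideals \<and> B \<subseteq> A}"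
  then show "x \<in> gen_transform S A"
    using gen_transform_mono by blast
qed

theorem theorem2p6:
  fixes S :: "'a::idom fract set set"
  assumes "multiplicative_set S"
    and "\<forall>I\<in>S. fin_gen I \<and> I \<noteq> {0}"
  shows "(star_operation (gen_transform S) \<longleftrightarrow> S \<subseteq> v_dense_ideals) \<and>
    (S \<subseteq> v_dense_ideals \<longrightarrow> finite_character (gen_transform S))"
proof -
  \<comment> \<open>This equation on \<open>D\<close> links both sides: every star-operation
    satisfies it, and it makes the transform a star-operation.\<close>
  have "gen_transform S dom_in_fract = dom_in_fract \<longleftrightarrow> S \<subseteq> v_dense_ideals"
    using gen_transform_dom_eq_iff assms by blast
  then show ?thesis
    using assms star_operation_gen_transform star_operation_dom finite_character_gen_transform
    by metis
qed

end
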